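(* Let $(V,B)$ be a Steiner system of type $S(t,n,v)$, where $t<n\le v$, and let $C=C_{(n,v)}\setminus B$ be the set of all $n$-subsets of $V$ that are not blocks. Then the simplicial complex $\Delta_C=\langle V\setminus\sigma \mid \sigma\in C\rangle$ is a matroid.
   Context: A Steiner system $(V,B)$ of type $S(t,n,v)$ consists of a set $V$ with $|V|=v$ and a collection $B$ of $n$-subsets of $V$ (blocks) such that every $t$-subset of $V$ is contained in a unique block. $C_{(n,v)}$ denotes the set of all $n$-subsets of $V$. $\langle F_1,\dots,F_q\rangle$ denotes the simplicial complex with facets $F_1,\dots,F_q$, i.e. the collection of all subsets of the $F_i$. A simplicial complex $\Delta$ is a matroid if for all $F,G\in\Delta$ with $|F|>|G|$ there exists $i\in F\setminus G$ such that $G\cup\{i\}\in\Delta$. *)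

theory Defs
  imports "HOL-Library.Ramsey"
begin

text \<open>The set of all \<open>k\<close>-subsets of \<open>V\<close> is \<^term>\<open>nsets V k\<close>.\<close>

definition steiner_system :: "nat \<Rightarrow> nat \<Rightarrow> nat \<Rightarrow> 'a set \<Rightarrow> 'a set set \<Rightarrow> bool" where
  "steiner_system t n v V B \<longleftrightarrow>
     finite V \<and> card V = v \<and> B \<subseteq> nsets V n \<and>
     (\<forall>T \<in> nsets V t. \<exists>!b. b \<in> B \<and> T \<subseteq> b)"

text \<open>Vertices of the ground set need not be faces. The complex without any faces is allowed;
  it is the one generated by an empty family of facets.\<close>

definition simplicial_complex :: "'a set \<Rightarrow> 'a set set \<Rightarrow> bool" where
  "simplicial_complex V \<Delta> \<longleftrightarrow>
     finite V \<and> (\<forall>F \<in> \<Delta>. F \<subseteq> V) \<and> (\<forall>F \<in> \<Delta>. \<forall>G. G \<subseteq> F \<longrightarrow> G \<in> \<Delta>)"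

definition complex_generated_by :: "'a set set \<Rightarrow> 'a set set" where
  "complex_generated_by \<F> = {G. \<exists>F \<in> \<F>. G \<subseteq> F}"

definition matroid :: "'a set \<Rightarrow> 'a set set \<Rightarrow> bool" where
  "matroid V \<Delta> \<longleftrightarrow>
     simplicial_complex V \<Delta> \<and>
     (\<forall>F \<in> \<Delta>. \<forall>G \<in> \<Delta>. card F > card G \<longrightarrow> (\<exists>i \<in> F - G. G \<union> {i} \<in> \<Delta>))"

end

theory Submission
  imports Defs
begin

text \<open>Distinct blocks share fewer than \<open>t\<close> points, so two \<open>n\<close>-sets that differ by the exchange of
  a single point are never both blocks. Hence every \<open>(n + 1)\<close>-set contains a non-block, and a set
  \<open>G\<close> is a face iff its complement has at least \<open>n\<close> points and is not a block. In the exchange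
  axiom only the case \<open>card (V - G) = n + 1\<close> matters: either \<open>F - G\<close> has two points, and removing
  at least one of them from \<open>V - G\<close> leaves a non-block, or \<open>F\<close> itself is \<open>G\<close> with one point added.\<close>

lemma steiner_blocks_not_adjacent:
  assumes S: "steiner_system t n v V B" and "t < n"
    and W: "W \<subseteq> V" "card W = Suc n" and ij: "i \<in> W" "j \<in> W" "i \<noteq> j"
  shows "W - {i} \<notin> B \<or> W - {j} \<notin> B"
proof (rule ccontr)
  assume "\<not> ?thesis"
  then have blocks: "W - {i} \<in> B" "W - {j} \<in> B" by auto
  have "finite W"
    using S W by (auto simp: steiner_system_def intro: finite_subset)
  \<comment> \<open>\<open>W - {i, j}\<close> is the intersection of the two supposed blocks. As
    \<open>t < n\<close>, it has room for a \<open>t\<close>-set, which would then lie in two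
    different blocks.\<close>
  then have "card (W - {i, j}) = n - 1"
    using W ij by (simp add: card_Diff_subset)
  then have "t \<le> card (W - {i, j})"
    using \<open>t < n\<close> by simp
  then obtain T where T: "T \<subseteq> W - {i, j}" "card T = t" "finite T"
    by (rule obtain_subset_with_card_n)
  then have "T \<in> nsets V t"
    using W by (auto simp: nsets_def)
  then have "\<exists>!b. b \<in> B \<and> T \<subseteq> b"
    using S by (auto simp: steiner_system_def)
  moreover have "T \<subseteq> W - {i}" "T \<subseteq> W - {j}"
    using T by auto
  ultimately have "W - {i} = W - {j}"
    using blocks by blast
  then show False
    using ij by blast
qed

text \<open>Passing to complements, \<open>G\<close> is a face iff some non-block fits inside
  \<open>V - G\<close>. If \<open>V - G\<close> has exactly \<open>n\<close> points, it is the only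
  candidate; if it has more, a non-block always fits.\<close>

lemma nonblock_complement_face_iff:
  assumes S: "steiner_system t n v V B" and "t < n"
  shows "G \<in> complex_generated_by {V - \<sigma> | \<sigma>. \<sigma> \<in> nsets V n - B} \<longleftrightarrow>
    G \<subseteq> V \<and> n \<le> card (V - G) \<and> V - G \<notin> B"
    (is "?L \<longleftrightarrow> ?R")
proof -
  have fin: "finite V" and B: "B \<subseteq> nsets V n"
    using S by (auto simp: steiner_system_def)
  have L: "?L \<longleftrightarrow> G \<subseteq> V \<and> (\<exists>\<sigma> \<in> nsets V n - B. \<sigma> \<subseteq> V - G)"
  proof -
    have "?L \<longleftrightarrow> (\<exists>\<sigma> \<in> nsets V n - B. G \<subseteq> V - \<sigma>)"
      by (auto simp: complex_generated_by_def)
    moreover have "G \<subseteq> V - \<sigma> \<longleftrightarrow> G \<subseteq> V \<and> \<sigma> \<subseteq> V - G" if "\<sigma> \<in> nsets V n" for \<sigma>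
      using that by (auto simp: nsets_def)
    ultimately show ?thesis
      by auto
  qed
  show ?thesis
  proof
    assume ?L
    then obtain \<sigma> where G: "G \<subseteq> V" and \<sigma>: "\<sigma> \<in> nsets V n - B" "\<sigma> \<subseteq> V - G"
      using L by blast
    have "n \<le> card (V - G)"
      using \<sigma> fin card_mono[of "V - G" \<sigma>] by (auto simp: nsets_def)
    moreover have "V - G \<notin> B"
    proof
      assume "V - G \<in> B"
      then have "\<sigma> = V - G"
        using \<sigma> B fin by (intro card_subset_eq) (auto simp: nsets_def)
      then show False
        using \<sigma> \<open>V - G \<in> B\<close> by blast
    qed
    ultimately show ?R
      using G by blast
  next
    assume R: ?R
    have "\<exists>\<sigma> \<in> nsets V n - B. \<sigma> \<subseteq> V - G"
    proof (cases "card (V - G) = n")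
      case True
      then show ?thesis
        using R fin by (intro bexI[of _ "V - G"]) (auto simp: nsets_def)
    next
      case False
      then have "Suc n \<le> card (V - G)"
        using R by simp
      then obtain W where W: "W \<subseteq> V - G" "card W = Suc n" "finite W"
        by (rule obtain_subset_with_card_n)
      \<comment> \<open>From \<open>t < n\<close> follows \<open>0 < n\<close>, so \<open>W\<close>
        has at least two points.\<close>
      then obtain i j where ij: "i \<in> W" "j \<in> W" "i \<noteq> j"
        using \<open>t < n\<close> card_le_Suc0_iff_eq[of W] by force
      have "W - {i} \<notin> B \<or> W - {j} \<notin> B"
        using W ij by (intro steiner_blocks_not_adjacent[OF S \<open>t < n\<close>]) auto
      moreover have "W - {i} \<in> nsets V n" "W - {j} \<in> nsets V n"
        using W ij by (auto simp: nsets_def)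
      ultimately show ?thesis
        using W by blast
    qed
    then show ?L
      using L R by blast
  qed
qed

theorem theorem3p4:
  fixes V :: "'a set" and B C :: "'a set set" and t n v :: nat
  assumes "steiner_system t n v V B"
    and "t < n" and "n \<le> v"
    and "C = nsets V n - B"
  shows "matroid V (complex_generated_by {V - \<sigma> | \<sigma>. \<sigma> \<in> C})"
proof -
  let ?\<Delta> = "complex_generated_by {V - \<sigma> | \<sigma>. \<sigma> \<in> C}"
  have fin: "finite V" and B: "B \<subseteq> nsets V n"
    using assms(1) by (auto simp: steiner_system_def)
  have face: "G \<in> ?\<Delta> \<longleftrightarrow> G \<subseteq> V \<and> n \<le> card (V - G) \<and> V - G \<notin> B" for G
    using nonblock_complement_face_iff[OF assms(1,2)] assms(4) by simp
  have "simplicial_complex V ?\<Delta>"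
    using fin by (auto simp: simplicial_complex_def complex_generated_by_def)
  moreover have "\<exists>i \<in> F - G. G \<union> {i} \<in> ?\<Delta>"
    if F: "F \<in> ?\<Delta>" and G: "G \<in> ?\<Delta>" and less: "card G < card F" for F G
  proof -
    have FV: "F \<subseteq> V" and GV: "G \<subseteq> V" and nF: "n \<le> card (V - F)"
      using F G face by auto
    have finF: "finite F" and finG: "finite G"
      using FV GV fin by (simp_all add: finite_subset)
    obtain i where i: "i \<in> F - G"
      using less finG card_mono[of G F] by fastforce
    \<comment> \<open>This bound keeps the natural-number subtraction \<open>card V - card F\<close>
      from truncating.\<close>
    have "card F \<le> card V"
      using FV fin by (rule card_mono[rotated])
    then have nG: "n < card (V - G)"
      using nF less FV GV finF finG by (simp add: card_Diff_subset)
    \<comment> \<open>The size condition for faces is already secured by \<open>nG\<close>; only the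
      block condition remains.\<close>
    have add: "G \<union> {k} \<in> ?\<Delta>" if "k \<in> F - G" "V - G - {k} \<notin> B" for k
    proof -
      have "V - (G \<union> {k}) = V - G - {k}" by blast
      then show ?thesis
        using that FV GV nG fin face by auto
    qed
    show ?thesis
    proof (cases "F - G = {i}")
      case True
      \<comment> \<open>Counting forces \<open>G\<close> into \<open>F\<close>, so the enlarged set
        is the known face \<open>F\<close>.\<close>
      have "card (F \<inter> G) = card F - 1"
        using True finF card_Diff_subset_Int[of F G] card_Int_Diff[of F G] by simp
      then have "card G \<le> card (F \<inter> G)"
        using less by simp
      then have "F \<inter> G = G"
        using finG by (intro card_seteq) auto
      then have "G \<union> {i} = F"
        using True by blast
      then show ?thesis
        using i F by auto
    next
      case False
      then obtain j where j: "j \<in> F - G" "j \<noteq> i"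
        using i by blast
      have "V - G - {i} \<notin> B \<or> V - G - {j} \<notin> B"
      proof (cases "card (V - G) = Suc n")
        case True
        then show ?thesis
          using i j FV by (intro steiner_blocks_not_adjacent[OF assms(1,2)]) auto
      next
        case False
        \<comment> \<open>Here \<open>V - G\<close> has at least \<open>n + 2\<close> points, so
          removing one leaves too many for a block.\<close>
        then have "card (V - G - {i}) \<noteq> n"
          using nG i FV fin by (auto simp: card_Diff_singleton_if)
        then show ?thesis
          using B by (auto simp: nsets_def)
      qed
      then show ?thesis
        using add i j by blast
    qed
  qed
  ultimately show ?thesis
    unfolding matroid_def by blast
qed

end
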